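(* Let $N\ge 0$ be an integer. The CVT-XOR Tree with root $(0,N)$ has exactly $N+1$ nodes; that is, every pair $(X,Y)$ of non-negative integers with $X+Y=N$ belongs to it.
   Context: For non-negative integers $X,Y$ written in binary, $\mathrm{XOR}(X,Y)$ is their bitwise exclusive or, and the Carry Value Transformation is $\mathrm{CVT}(X,Y)=2\cdot(X \mathbin{\mathrm{AND}} Y)$, i.e. the bitwise AND shifted one position to the left with a $0$ appended as least significant bit. Define $f(X,Y)=(\mathrm{CVT}(X,Y),\mathrm{XOR}(X,Y))$; then $X+Y=\mathrm{CVT}(X,Y)+\mathrm{XOR}(X,Y)$. For an integer $N\ge 0$, the CVT-XOR Tree with root $(0,N)$ has as nodes pairs $(X,Y)$ of non-negative integers with $X+Y=N$; the root is $(0,N)$ (which satisfies $f(0,N)=(0,N)$, a self-loop), and a pair $(X,Y)$ is a node if iterating $f$ from $(X,Y)$ eventually reaches $(0,N)$, in which case the parent of a non-root node $(X,Y)$ is $f(X,Y)$. *)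

theory Defs
  imports Complex_Main "Graph_Theory.Pair_Digraph"
begin

definition XOR :: "nat \<Rightarrow> nat \<Rightarrow> nat" where
  "XOR X Y = xor X Y"

definition CVT :: "nat \<Rightarrow> nat \<Rightarrow> nat" where
  "CVT X Y = 2 * and X Y"

definition cvt_xor :: "nat \<times> nat \<Rightarrow> nat \<times> nat" where
  "cvt_xor = (\<lambda>(X, Y). (CVT X Y, XOR X Y))"

(* Arcs point from a node to its parent. The fixed point (0, N) is the root; its
   self-loop under cvt_xor is not an arc, since the root has no parent. *)
definition cvt_xor_tree :: "nat \<Rightarrow> (nat \<times> nat) pair_pre_digraph" where
  "cvt_xor_tree N =
     (let V = {(X, Y). X + Y = N \<and> (\<exists>k. (cvt_xor ^^ k) (X, Y) = (0, N))}
      in \<lparr> pverts = V, parcs = {(v, cvt_xor v) | v. v \<in> V \<and> v \<noteq> (0, N)} \<rparr>)"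

end

theory Submission
  imports Defs
begin

text \<open>Each step of \<^const>\<open>cvt_xor\<close> preserves the sum \<open>X + Y\<close> and adds a factor 2 to the first
  component. After \<open>N\<close> steps the first component is therefore a multiple of \<open>2 ^ N\<close> that is at most
  \<open>N < 2 ^ N\<close>, that is, \<open>0\<close>.\<close>

text \<open>This is binary addition with the carries kept apart: \<open>and\<close> marks the
  positions that produce a carry, \<open>xor\<close> gives the digit sums without carry. The
  induction splits off the lowest bit and halves.\<close>

lemma and_xor_add: "2 * and x y + xor x y = x + (y::nat)"
proof (induction x arbitrary: y rule: less_induct)
  case (less x)
  show ?case
  proof (cases "x = 0")
    case False
    then have "2 * and (x div 2) (y div 2) + xor (x div 2) (y div 2) = x div 2 + y div 2"
      by (intro less) simp
    moreover have "and x y = of_bool (odd x \<and> odd y) + 2 * and (x div 2) (y div 2)"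
      by (rule and_rec)
    moreover have "xor x y = of_bool (odd x \<noteq> odd y) + 2 * xor (x div 2) (y div 2)"
      by (rule xor_rec)
    \<comment> \<open>The half adder on the lowest bits.\<close>
    moreover have "2 * of_bool (odd x \<and> odd y) + of_bool (odd x \<noteq> odd y) =
        (of_bool (odd x) + of_bool (odd y) :: nat)"
      by simp
    moreover have "x = of_bool (odd x) + 2 * (x div 2)" "y = of_bool (odd y) + 2 * (y div 2)"
      by simp_all
    ultimately show ?thesis
      by linarith
  qed simp
qed

text \<open>Divisibility by \<open>2 ^ n\<close> means that the \<open>n\<close> lowest bits vanish,
  and \<open>and\<close> cannot set a bit that is zero in \<open>x\<close>.\<close>

lemma dvd_and_left:
  assumes "2 ^ n dvd (x::nat)"
  shows "2 ^ n dvd and x y"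
  using assms by (auto simp: take_bit_and simp flip: take_bit_eq_0_iff)

lemma cvt_xor_sum: "fst (cvt_xor p) + snd (cvt_xor p) = fst p + snd p"
  by (simp add: cvt_xor_def CVT_def XOR_def and_xor_add split: prod.split)

lemma funpow_cvt_xor_sum:
  "fst ((cvt_xor ^^ n) p) + snd ((cvt_xor ^^ n) p) = fst p + snd p"
  by (induction n) (simp_all add: cvt_xor_sum)

lemma fst_cvt_xor: "fst (cvt_xor p) = 2 * and (fst p) (snd p)"
  by (simp add: cvt_xor_def CVT_def split: prod.split)

lemma funpow_cvt_xor_dvd: "2 ^ n dvd fst ((cvt_xor ^^ n) p)"
  by (induction n) (simp_all add: fst_cvt_xor dvd_and_left)

lemma funpow_cvt_xor_eq_root: "(cvt_xor ^^ (x + y)) (x, y) = (0, x + y)"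
proof -
  let ?p = "(cvt_xor ^^ (x + y)) (x, y)"
  have sum: "fst ?p + snd ?p = x + y"
    using funpow_cvt_xor_sum[of "x + y" "(x, y)"] by simp
  then have "fst ?p < 2 ^ (x + y)"
    using less_exp[of "x + y"] by linarith
  then have "fst ?p = 0"
    using funpow_cvt_xor_dvd[of "x + y" "(x, y)"] nat_dvd_not_less by blast
  with sum show ?thesis
    by (simp add: prod_eq_iff)
qed

text \<open>The witness for the number \<open>k\<close> of iterations is
  \<open>X + Y\<close>.\<close>

lemma pverts_cvt_xor_tree: "pverts (cvt_xor_tree N) = {(X, Y). X + Y = N}"
  by (auto simp: cvt_xor_tree_def Let_def intro: funpow_cvt_xor_eq_root)

theorem theorem1:
  fixes N :: nat
  shows "card (pverts (cvt_xor_tree N)) = N + 1 \<and>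
         (\<forall>X Y. X + Y = N \<longrightarrow> (X, Y) \<in> pverts (cvt_xor_tree N))"
proof -
  \<comment> \<open>The first component determines the pair; the truncated subtraction is exact
    because \<open>X\<close> \<le> \<open>N\<close>.\<close>
  have "{(X, Y). X + Y = N} = (\<lambda>X. (X, N - X)) ` {..N}"
    by (auto simp: image_iff)
  moreover have "inj_on (\<lambda>X. (X, N - X)) {..N}"
    by (simp add: inj_on_def)
  ultimately have "card {(X, Y). X + Y = N} = N + 1"
    by (simp add: card_image)
  then show ?thesis
    by (simp add: pverts_cvt_xor_tree)
qed

end
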